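(* For $2\le n\le4$, every $S\in\mathcal{G}_n$ has $K_S=C_S$. The smallest $n$ for which some $S\in\mathcal{G}_n$ has $K_S\ne C_S$ is $n=5$. At this length, the unique sequence $S\in\mathcal{G}_5$ with $K_S\neq C_S$ is $S=(2,3,5,9,15)$. Explicitly, for this $S$, $$C_S=\{5,7,9,11,13,15,17,19,21,23,25\},\qquad K_S=\{5,7,9,11,13,17,19,21,23,25\},$$ so $H_S=\{15\}$.
   Context: For a finite integer sequence $S=(s_1,\ldots,s_n)$, its difference triangle is defined by $s_a^0:=s_a$ and $s_a^b:=|s_{a+1}^{b-1}-s_a^{b-1}|$ for $b\ge 1$, $1\le a\le n-b$ (superscripts are row indices, not powers). $S$ is Gilbreath if $s_1^b=1$ for every $1\le b\le n-1$. For $n\ge 2$, $\mathcal{G}_n$ is the set of strictly increasing Gilbreath integer sequences $(s_1,\ldots,s_n)$ of length $n$ with $(s_1,s_2)=(2,3)$. The valid-extension set of $S$ is $K_S:=\{k\in\mathbb{Z}:(s_1,\ldots,s_n,k)\text{ is Gilbreath}\}$. The right anti-diagonal of $S$ is $(e_1,\ldots,e_{n-1})$ with $e_i:=s_{n-i}^i$, and $A(S):=\sum_{i=1}^{n-1}e_i$. The candidate set is $C_S:=\{k\in\mathbb{Z}:|k-s_n|\le A(S)+1,\ k\equiv s_n\pmod 2\}$, and the hole set is $H_S:=C_S\setminus K_S$. *)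

theory Defs
  imports "HOL-Number_Theory.Cong"
begin

text \<open>
  A finite integer sequence \<open>(s\<^sub>1, \<dots>, s\<^sub>n)\<close> is an \<open>int list\<close> of length \<open>n\<close>.  Positions are
  counted from 1, so that \<open>s\<^sub>a\<close> is \<open>S ! (a - 1)\<close>.  The entry \<open>tri S b a\<close> (row \<open>b\<close>,
  position \<open>a\<close>) is meaningful only for \<open>1 \<le> a\<close> and \<open>a + b \<le> length S\<close>; all uses below
  respect this range.
\<close>

fun tri :: "int list \<Rightarrow> nat \<Rightarrow> nat \<Rightarrow> int" where
  "tri S 0 a = S ! (a - 1)"
| "tri S (Suc b) a = \<bar>tri S b (a + 1) - tri S b a\<bar>"

definition gilbreath :: "int list \<Rightarrow> bool" where
  "gilbreath S \<longleftrightarrow> (\<forall>b. 1 \<le> b \<and> b < length S \<longrightarrow> tri S b 1 = 1)"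

text \<open>The condition on the first two terms forces \<open>n \<ge> 2\<close>: the set is empty for \<open>n < 2\<close>.\<close>

definition gilbreath_seqs :: "nat \<Rightarrow> int list set" where
  "gilbreath_seqs n =
     {S. length S = n \<and> sorted_wrt (<) S \<and> gilbreath S \<and> take 2 S = [2, 3]}"

definition valid_exts :: "int list \<Rightarrow> int set" where
  "valid_exts S = {k. gilbreath (S @ [k])}"

definition right_antidiag :: "int list \<Rightarrow> nat \<Rightarrow> int" where
  "right_antidiag S i = tri S i (length S - i)"

definition antidiag_sum :: "int list \<Rightarrow> int" where
  "antidiag_sum S = (\<Sum>i\<in>{1..<length S}. right_antidiag S i)"

definition candidates :: "int list \<Rightarrow> int set" where
  "candidates S = {k. \<bar>k - last S\<bar> \<le> antidiag_sum S + 1 \<and> [k = last S] (mod 2)}"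

definition holes :: "int list \<Rightarrow> int set" where
  "holes S = candidates S - valid_exts S"

end

(* A prefix of a Gilbreath sequence is Gilbreath, so G_{n+1} arises from G_n by appending to each S
   the elements of K_S above its last term.  Starting from (2,3), this leaves one sequence of length
   3, two of length 4 and six of length 5.  The condition that k extends S is a nest of
   equations |x - e_i| = c, which is solved from the outside in; the resulting finite set K_S is
   compared with C_S for each of the ten sequences. *)

theory Submission
  imports Defs
begin

text \<open>The entry in row \<open>b\<close> at position \<open>a\<close> is built from the terms
  at positions \<open>a\<close> to \<open>a + b\<close> only, all of which lie in
  \<open>S\<close>.\<close>

lemma tri_append:
  "1 \<le> a \<Longrightarrow> a + b \<le> length S \<Longrightarrow> tri (S @ T) b a = tri S b a"
  by (induction b arbitrary: a) (auto simp: nth_append)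

lemma gilbreath_appendD: "gilbreath (S @ T) \<Longrightarrow> gilbreath S"
  using tri_append[of 1 _ S T] by (force simp: gilbreath_def)

lemma gilbreath_seqs_2: "gilbreath_seqs 2 = {[2, 3]}"
proof -
  have "gilbreath [2, 3]" by (auto simp: gilbreath_def less_Suc_eq)
  then show ?thesis by (auto simp: gilbreath_seqs_def)
qed

text \<open>Since 2 \<le> \<open>n\<close>, the condition on the first two terms concerns
  \<open>S\<close> alone. As \<open>S\<close> is increasing, \<open>k\<close> only has to be
  compared with its last term.\<close>

lemma gilbreath_seqs_Suc:
  assumes "2 \<le> n"
  shows "gilbreath_seqs (Suc n) =
    (\<Union>S\<in>gilbreath_seqs n. (\<lambda>k. S @ [k]) ` (valid_exts S \<inter> {last S<..}))" (is "?L = ?R")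
proof (intro equalityI subsetI)
  fix T assume T: "T \<in> ?L"
  then obtain S k where [simp]: "T = S @ [k]" and len: "length S = n"
    by (auto simp: gilbreath_seqs_def length_Suc_conv_rev)
  moreover have "S \<noteq> []" using len assms by auto
  ultimately show "T \<in> ?R" using T assms
    by (auto simp: gilbreath_seqs_def valid_exts_def sorted_wrt_append dest: gilbreath_appendD)
next
  fix T assume "T \<in> ?R"
  then obtain S k where [simp]: "T = S @ [k]" and S: "S \<in> gilbreath_seqs n"
    and k: "k \<in> valid_exts S" "last S < k" by auto
  have "S \<noteq> []" using S by (auto simp: gilbreath_seqs_def)
  moreover have "x \<le> last S" if "x \<in> set S" for x
    using that S \<open>S \<noteq> []\<close>
    by (cases S rule: rev_cases) (auto simp: gilbreath_seqs_def sorted_wrt_append)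
  ultimately show "T \<in> ?L" using S k assms
    by (force simp: gilbreath_seqs_def valid_exts_def sorted_wrt_append)
qed

lemma tri_numeral:
  "tri S (numeral m) a = \<bar>tri S (pred_numeral m) (a + 1) - tri S (pred_numeral m) a\<bar>"
  by (simp add: numeral_eq_Suc)

text \<open>Filtering an interval list by parity turns the set into something that rewriting can
  evaluate.\<close>

lemma candidates_eq:
  "candidates S =
    (let m = (\<Sum>i\<leftarrow>[1..<length S]. tri S i (length S - i)) + 1
     in set (filter (\<lambda>k. k mod 2 = last S mod 2) [last S - m..last S + m]))"
  by (auto simp: Let_def candidates_def antidiag_sum_def right_antidiag_def cong_def
      sum_list_distinct_conv_sum_set)

lemma gilbreath_iff: "gilbreath S \<longleftrightarrow> (\<forall>b\<in>set [1..<length S]. tri S b 1 = 1)"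
  by (auto simp: gilbreath_def)

lemma candidates_small:
  "candidates [2, 3] = {1, 3, 5}"
  "candidates [2, 3, 5] = {1, 3, 5, 7, 9}"
  "candidates [2, 3, 5, 7] = {3, 5, 7, 9, 11}"
  "candidates [2, 3, 5, 9] = {1, 3, 5, 7, 9, 11, 13, 15, 17}"
  "candidates [2, 3, 5, 7, 9] = {5, 7, 9, 11, 13}"
  "candidates [2, 3, 5, 7, 11] = {1, 3, 5, 7, 9, 11, 13, 15, 17, 19, 21}"
  "candidates [2, 3, 5, 9, 11] = {5, 7, 9, 11, 13, 15, 17}"
  "candidates [2, 3, 5, 9, 13] = {5, 7, 9, 11, 13, 15, 17, 19, 21}"
  "candidates [2, 3, 5, 9, 15] = {5, 7, 9, 11, 13, 15, 17, 19, 21, 23, 25}"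
  "candidates [2, 3, 5, 9, 17] = {1, 3, 5, 7, 9, 11, 13, 15, 17, 19, 21, 23, 25, 27, 29, 31, 33}"
  \<comment> \<open>The intervals start at 1, 3 or 5; as \<open>1\<close> is not a
    \<open>numeral\<close> term, it gets its own instance of \<open>upto.simps\<close>. Removing
    \<open>set_filter\<close> keeps the filter on an explicit list.\<close>
  by (simp_all add: candidates_eq tri_numeral upt_rec upto.simps[of 1]
      del: upt_Suc set_filter)

text \<open>If the later antidiagonal entries have sum r, and the values they admit are all even
  numbers from 0 to r + 1, then an even entry e admits all even numbers from 0 to e + r + 1 exactly
  when e \<le> r + 1. This holds throughout for nine of the sequences. For
  \<open>[2, 3, 5, 9, 15]\<close> the antidiagonal is (6, 2, 0, 1), and 6 > 2 + 0 + 1 + 1: the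
  distance of \<open>k\<close> from 15 is 2, 4, 6, 8 or 10, never 0.\<close>

lemma valid_exts_small:
  "valid_exts [2, 3] = {1, 3, 5}"
  "valid_exts [2, 3, 5] = {1, 3, 5, 7, 9}"
  "valid_exts [2, 3, 5, 7] = {3, 5, 7, 9, 11}"
  "valid_exts [2, 3, 5, 9] = {1, 3, 5, 7, 9, 11, 13, 15, 17}"
  "valid_exts [2, 3, 5, 7, 9] = {5, 7, 9, 11, 13}"
  "valid_exts [2, 3, 5, 7, 11] = {1, 3, 5, 7, 9, 11, 13, 15, 17, 19, 21}"
  "valid_exts [2, 3, 5, 9, 11] = {5, 7, 9, 11, 13, 15, 17}"
  "valid_exts [2, 3, 5, 9, 13] = {5, 7, 9, 11, 13, 15, 17, 19, 21}"
  "valid_exts [2, 3, 5, 9, 15] = {5, 7, 9, 11, 13, 17, 19, 21, 23, 25}"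
  "valid_exts [2, 3, 5, 9, 17] = {1, 3, 5, 7, 9, 11, 13, 15, 17, 19, 21, 23, 25, 27, 29, 31, 33}"
  \<comment> \<open>\<open>abs_eq_iff'\<close> removes the outermost absolute value and
    \<open>diff_eq_eq\<close> moves the known entry across, repeatedly down to
    \<open>k\<close>.\<close>
  by (simp_all add: valid_exts_def gilbreath_iff tri_numeral upt_rec set_eq_iff
      abs_eq_iff' diff_eq_eq) auto

text \<open>The extensions above the last term are 5 after 3; 7 and 9 after 5; 9 and 11 after 7; 11,
  13, 15 and 17 after 9.\<close>

lemma gilbreath_seqs_small:
  "gilbreath_seqs 3 = {[2, 3, 5]}"
  "gilbreath_seqs 4 = {[2, 3, 5, 7], [2, 3, 5, 9]}"
  "gilbreath_seqs 5 = {[2, 3, 5, 7, 9], [2, 3, 5, 7, 11], [2, 3, 5, 9, 11], [2, 3, 5, 9, 13],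
    [2, 3, 5, 9, 15], [2, 3, 5, 9, 17]}"
proof -
  show 3: "gilbreath_seqs 3 = {[2, 3, 5]}"
    using gilbreath_seqs_Suc[of 2] by (auto simp: gilbreath_seqs_2 valid_exts_small)
  show 4: "gilbreath_seqs 4 = {[2, 3, 5, 7], [2, 3, 5, 9]}"
    using gilbreath_seqs_Suc[of 3] by (auto simp: 3 valid_exts_small)
  show "gilbreath_seqs 5 = {[2, 3, 5, 7, 9], [2, 3, 5, 7, 11], [2, 3, 5, 9, 11], [2, 3, 5, 9, 13],
    [2, 3, 5, 9, 15], [2, 3, 5, 9, 17]}"
    using gilbreath_seqs_Suc[of 4] by (auto simp: 4 valid_exts_small)
qed

theorem theorem24:
  shows "(\<forall>n. 2 \<le> n \<and> n \<le> 4 \<longrightarrow> (\<forall>S\<in>gilbreath_seqs n. valid_exts S = candidates S))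
    \<and> (\<exists>S\<in>gilbreath_seqs 5. valid_exts S \<noteq> candidates S)
    \<and> (LEAST n. 2 \<le> n \<and> (\<exists>S\<in>gilbreath_seqs n. valid_exts S \<noteq> candidates S)) = 5
    \<and> {S \<in> gilbreath_seqs 5. valid_exts S \<noteq> candidates S} = {[2, 3, 5, 9, 15]}
    \<and> candidates [2, 3, 5, 9, 15] = {5, 7, 9, 11, 13, 15, 17, 19, 21, 23, 25}
    \<and> valid_exts [2, 3, 5, 9, 15] = {5, 7, 9, 11, 13, 17, 19, 21, 23, 25}
    \<and> holes [2, 3, 5, 9, 15] = {15}"
proof -
  let ?bad = "\<lambda>n. \<exists>S\<in>gilbreath_seqs n. valid_exts S \<noteq> candidates S"
  note small = gilbreath_seqs_2 gilbreath_seqs_small valid_exts_small candidates_small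
  have C: "\<forall>n. 2 \<le> n \<and> n \<le> 4 \<longrightarrow> (\<forall>S\<in>gilbreath_seqs n. valid_exts S = candidates S)"
  proof (intro allI impI)
    fix n :: nat assume "2 \<le> n \<and> n \<le> 4"
    then have "n = 2 \<or> n = 3 \<or> n = 4" by auto
    then show "\<forall>S\<in>gilbreath_seqs n. valid_exts S = candidates S" by (auto simp: small)
  qed
  have neq: "valid_exts [2, 3, 5, 9, 15] \<noteq> candidates [2, 3, 5, 9, 15]"
  proof
    assume "valid_exts [2, 3, 5, 9, 15] = candidates [2, 3, 5, 9, 15]"
    then have "15 \<in> valid_exts [2, 3, 5, 9, 15]" by (simp add: candidates_small)
    then show False by (simp add: valid_exts_small)
  qed
  then have bad: "?bad 5" by (simp add: gilbreath_seqs_small)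
  have "(LEAST n. 2 \<le> n \<and> ?bad n) = 5"
  proof (rule Least_equality)
    fix n assume "2 \<le> n \<and> ?bad n"
    \<comment> \<open>Lengths 2 to 4 have no exception by \<open>C\<close>, which gives the lower
      bound 5.\<close>
    with C have "\<not> n \<le> 4" by blast
    then show "5 \<le> n" by simp
  qed (use bad in simp)
  moreover have "{S \<in> gilbreath_seqs 5. valid_exts S \<noteq> candidates S} = {[2, 3, 5, 9, 15]}"
  proof -
    have "valid_exts S = candidates S"
      if "S \<in> gilbreath_seqs 5" "S \<noteq> [2, 3, 5, 9, 15]" for S
      \<comment> \<open>For each of the five other sequences both sides rewrite to literally the
        same explicit set.\<close>
      using that unfolding gilbreath_seqs_small by (auto simp only: small insert_iff empty_iff)
    moreover have "[2, 3, 5, 9, 15] \<in> gilbreath_seqs 5" by (simp add: gilbreath_seqs_small)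
    ultimately show ?thesis using neq by blast
  qed
  moreover have "holes [2, 3, 5, 9, 15] = {15}"
    by (auto simp: holes_def candidates_small valid_exts_small)
  ultimately show ?thesis
    using C bad candidates_small(9) valid_exts_small(9) by blast
qed

end
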